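(* Let $a,b$ be odd positive integers. For every positive integer $n$, $$t(a,3a,2b;n)=\frac 23N(a,3a,2b;8n+4a+2b).$$
   Context: For positive integers $a_1,\dots,a_k$ and a nonnegative integer $n$, $N(a_1,\dots,a_k;n)$ is the number of $(x_1,\dots,x_k)\in\mathbb Z^k$ with $n=a_1x_1^2+\cdots+a_kx_k^2$, and $t(a_1,\dots,a_k;n)$ is the number of $(x_1,\dots,x_k)\in\mathbb Z^k$ with $n=a_1\frac{x_1(x_1-1)}2+\cdots+a_k\frac{x_k(x_k-1)}2$. *)

theory Defs
  imports Complex_Main
begin

text \<open>The coefficients \<open>a\<^sub>1, \<dots>, a\<^sub>k\<close> form a list, and a tuple in \<open>\<int>\<^sup>k\<close> is an integer
  list of the same length. Both solution sets are finite when all coefficients are positive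
  (lemmas below), so that \<open>card\<close> is the actual number of representations.\<close>

definition square_reps :: "nat list \<Rightarrow> nat \<Rightarrow> int list set" where
  "square_reps as n =
     {xs. length xs = length as \<and> int n = (\<Sum>i<length as. int (as ! i) * (xs ! i)\<^sup>2)}"

definition N_reps :: "nat list \<Rightarrow> nat \<Rightarrow> nat" where
  "N_reps as n = card (square_reps as n)"

text \<open>The integer division by 2 is exact, since \<open>x (x - 1)\<close> is even.\<close>

definition triangular_reps :: "nat list \<Rightarrow> nat \<Rightarrow> int list set" where
  "triangular_reps as n =
     {xs. length xs = length as \<and>
          int n = (\<Sum>i<length as. int (as ! i) * (xs ! i * (xs ! i - 1) div 2))}"

definition t_reps :: "nat list \<Rightarrow> nat \<Rightarrow> nat" where
  "t_reps as n = card (triangular_reps as n)"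

lemma finite_reps_aux:
  fixes g :: "int \<Rightarrow> int" and as :: "nat list" and n :: nat
  assumes pos: "\<And>a. a \<in> set as \<Longrightarrow> 0 < a"
    and g: "\<And>x. \<bar>x\<bar> \<le> g x + 1" "\<And>x. 0 \<le> g x"
  shows "finite {xs. length xs = length as \<and> int n = (\<Sum>i<length as. int (as ! i) * g (xs ! i))}"
    (is "finite ?S")
proof (rule finite_subset)
  show "finite {xs. set xs \<subseteq> {- int n - 1..int n + 1} \<and> length xs = length as}"
    by (intro finite_lists_length_eq) simp
  show "?S \<subseteq> {xs. set xs \<subseteq> {- int n - 1..int n + 1} \<and> length xs = length as}"
  proof safe
    fix xs :: "int list" and x
    assume len: "length xs = length as"
      and n: "int n = (\<Sum>i<length as. int (as ! i) * g (xs ! i))" and x: "x \<in> set xs"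
    from x len obtain j where j: "j < length as" "x = xs ! j"
      by (metis in_set_conv_nth)
    have "1 \<le> int (as ! j)"
      using pos[of "as ! j"] j by simp
    then have "1 * g x \<le> int (as ! j) * g x"
      using g(2) by (intro mult_right_mono) auto
    also have "\<dots> \<le> (\<Sum>i<length as. int (as ! i) * g (xs ! i))"
      unfolding j(2) by (rule member_le_sum) (use j g(2) in auto)
    finally have "g x \<le> int n"
      using n by simp
    with g(1)[of x] show "x \<in> {- int n - 1..int n + 1}"
      by auto
  qed
qed

lemma finite_square_reps:
  assumes "\<And>a. a \<in> set as \<Longrightarrow> 0 < a"
  shows "finite (square_reps as n)"
  unfolding square_reps_def
proof (rule finite_reps_aux[OF assms])
  show "\<bar>x\<bar> \<le> x\<^sup>2 + 1" for x :: int
  proof (cases "x = 0")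
    case False
    then have "\<bar>x\<bar> \<le> x\<^sup>2"
      using self_le_power[of "\<bar>x\<bar>" 2] by simp
    then show ?thesis by linarith
  qed simp
qed auto

lemma finite_triangular_reps:
  assumes "\<And>a. a \<in> set as \<Longrightarrow> 0 < a"
  shows "finite (triangular_reps as n)"
  unfolding triangular_reps_def
proof (rule finite_reps_aux[OF assms])
  fix x :: int
  show "0 \<le> x * (x - 1) div 2"
    by (cases "x \<le> 0") (auto simp: mult_nonpos_nonpos)
  have "2 * \<bar>x\<bar> - 2 \<le> x * (x - 1)"
  proof -
    have "x \<le> -1 \<or> x = 0 \<or> x = 1 \<or> 2 \<le> x" by linarith
    moreover have "2 * \<bar>x\<bar> - 2 \<le> x * (x - 1)" if "x \<le> -1"
      using mult_left_mono_neg[of "x - 1" "-2" x] that by simp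
    moreover have "2 * \<bar>x\<bar> - 2 \<le> x * (x - 1)" if "2 \<le> x"
      using mult_right_mono[of 2 x "x - 1"] that by simp
    ultimately show ?thesis by auto
  qed
  then show "\<bar>x\<bar> \<le> x * (x - 1) div 2 + 1"
    by linarith
qed auto

end

theory Submission
  imports Defs
begin

text \<open>Completing the square, \<open>t(a,3a,2b;n)\<close> counts the solutions of
  \<open>a x\<^sup>2 + 3a y\<^sup>2 + 2b z\<^sup>2 = 8n + 4a + 2b\<close> in odd integers. Modulo 8, every solution has \<open>z\<close> odd
  and \<open>x \<equiv> y (mod 2)\<close>; the odd solutions split according to whether \<open>4\<close> divides \<open>x - y\<close> or
  \<open>x + y\<close>, and the sign change of \<open>y\<close> exchanges the two halves. The involution
  \<open>(x, y) \<mapsto> ((x + 3y)/2, (x - y)/2)\<close>, which is conjugation of \<open>x + y \<surd>-3\<close>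
  followed by multiplication by the sixth root of unity \<open>(1 + \<surd>-3)/2\<close>, preserves \<open>x\<^sup>2 + 3y\<^sup>2\<close>
  and exchanges the solutions with \<open>x\<close>, \<open>y\<close> even and the odd ones with \<open>4\<close> dividing \<open>x - y\<close>.
  So exactly two thirds of the solutions are odd.\<close>

text \<open>Triples replace lists so that maps on coordinates can be written by pattern matching;
  integer coefficients avoid truncated subtraction in the divisibility arguments.\<close>

definition ternary_sols :: "int \<Rightarrow> int \<Rightarrow> int \<Rightarrow> int \<Rightarrow> (int \<times> int \<times> int) set" where
  "ternary_sols a b c m = {(x, y, z). m = a * x\<^sup>2 + b * y\<^sup>2 + c * z\<^sup>2}"

lemma square_reps_ternary:
  "square_reps [a, b, c] m = (\<lambda>(x, y, z). [x, y, z]) ` ternary_sols (int a) (int b) (int c) (int m)"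
proof (intro equalityI subsetI)
  fix xs assume "xs \<in> square_reps [a, b, c] m"
  then have len: "length xs = Suc (Suc (Suc 0))"
    and eq: "int m = (\<Sum>i<3. int ([a, b, c] ! i) * (xs ! i)\<^sup>2)"
    by (auto simp: square_reps_def eval_nat_numeral)
  from len obtain x y z where "xs = [x, y, z]"
    by (auto simp: length_Suc_conv)
  with eq show "xs \<in> (\<lambda>(x, y, z). [x, y, z]) ` ternary_sols (int a) (int b) (int c) (int m)"
    by (intro image_eqI[of _ _ "(x, y, z)"]) (auto simp: ternary_sols_def eval_nat_numeral)
qed (auto simp: ternary_sols_def square_reps_def eval_nat_numeral)

lemma inj_triple_list: "inj_on (\<lambda>(x, y, z). [x, y, z]) A"
  by (auto simp: inj_on_def)

lemma N_reps_ternary: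
  "N_reps [a, b, c] m = card (ternary_sols (int a) (int b) (int c) (int m))"
  unfolding N_reps_def square_reps_ternary by (rule card_image) (rule inj_triple_list)

lemma finite_ternary_sols:
  assumes "0 < a" "0 < b" "0 < c"
  shows "finite (ternary_sols (int a) (int b) (int c) (int m))"
proof -
  have "finite (square_reps [a, b, c] m)"
    by (rule finite_square_reps) (use assms in auto)
  then show ?thesis
    unfolding square_reps_ternary by (rule finite_imageD) (rule inj_triple_list)
qed

text \<open>Completing the square: since \<open>x * (x - 1)\<close> is even, the division is exact.
  This links triangular numbers to odd squares and also shows that odd squares are 1 modulo
  8.\<close>

lemma square_two_mult_minus_one:
  fixes x :: int
  shows "(2 * x - 1)\<^sup>2 = 8 * (x * (x - 1) div 2) + 1"
proof -
  have "even (x * (x - 1))" by simp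
  then obtain k where "x * (x - 1) = 2 * k" by (rule evenE)
  then show ?thesis by (simp add: power2_eq_square algebra_simps)
qed

lemma odd_square_int:
  fixes x :: int
  assumes "odd x"
  obtains k where "x\<^sup>2 = 8 * k + 1"
proof -
  from assms obtain j where "x = 2 * j + 1" by (rule oddE)
  then have "x = 2 * (j + 1) - 1" by simp
  then show thesis using that square_two_mult_minus_one by blast
qed

text \<open>Multiply the triangular equation by 8 and add \<open>a + b + c\<close>; then x \<mapsto>
  2x - 1, a bijection from the integers onto the odd integers, acts on each coordinate.\<close>

lemma t_reps_ternary:
  "t_reps [a, b, c] n =
     card {(x, y, z) \<in> ternary_sols (int a) (int b) (int c) (int (8 * n + a + b + c)).
       odd x \<and> odd y \<and> odd z}" (is "_ = card ?O")
proof -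
  let ?T = "{(x, y, z). int n = int a * (x * (x - 1) div 2) + int b * (y * (y - 1) div 2)
    + int c * (z * (z - 1) div 2)}"
  have "triangular_reps [a, b, c] n = (\<lambda>(x, y, z). [x, y, z]) ` ?T"
  proof (intro equalityI subsetI)
    fix xs assume "xs \<in> triangular_reps [a, b, c] n"
    then have len: "length xs = Suc (Suc (Suc 0))"
      and eq: "int n = (\<Sum>i<3. int ([a, b, c] ! i) * (xs ! i * (xs ! i - 1) div 2))"
      by (auto simp: triangular_reps_def eval_nat_numeral)
    from len obtain x y z where "xs = [x, y, z]"
      by (auto simp: length_Suc_conv)
    with eq show "xs \<in> (\<lambda>(x, y, z). [x, y, z]) ` ?T"
      by (intro image_eqI[of _ _ "(x, y, z)"]) (auto simp: eval_nat_numeral)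
  qed (auto simp: triangular_reps_def eval_nat_numeral)
  then have "t_reps [a, b, c] n = card ?T"
    unfolding t_reps_def by (simp add: card_image inj_triple_list)
  also have "card ?T = card ?O"
  proof (rule bij_betw_same_card)
    have sol: "(2 * x - 1, 2 * y - 1, 2 * z - 1) \<in> ?O \<longleftrightarrow> (x, y, z) \<in> ?T" for x y z
    proof -
      have "8 * int n + int a + int b + int c
          = int a * (8 * p + 1) + int b * (8 * q + 1) + int c * (8 * r + 1)
        \<longleftrightarrow> int n = int a * p + int b * q + int c * r" for p q r
        by (auto simp: algebra_simps)
      then show ?thesis
        by (simp add: ternary_sols_def square_two_mult_minus_one)
    qed
    show "bij_betw (\<lambda>(x, y, z). (2 * x - 1, 2 * y - 1, 2 * z - 1)) ?T ?O"
      unfolding bij_betw_def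
    proof (intro conjI equalityI subsetI)
      fix p assume p: "p \<in> ?O"
      then obtain x y z where xyz: "p = (x, y, z)" "odd x" "odd y" "odd z" by auto
      then obtain i j k where "x = 2 * i + 1" "y = 2 * j + 1" "z = 2 * k + 1" by (elim oddE)
      then have p': "p = (2 * (i + 1) - 1, 2 * (j + 1) - 1, 2 * (k + 1) - 1)"
        using xyz(1) by simp
      have "(i + 1, j + 1, k + 1) \<in> ?T"
        using p unfolding p' sol .
      then show "p \<in> (\<lambda>(x, y, z). (2 * x - 1, 2 * y - 1, 2 * z - 1)) ` ?T"
        by (rule rev_image_eqI) (simp add: p')
    next
      fix p assume "p \<in> (\<lambda>(x, y, z). (2 * x - 1, 2 * y - 1, 2 * z - 1)) ` ?T"
      then obtain x y z where "(x, y, z) \<in> ?T" "p = (2 * x - 1, 2 * y - 1, 2 * z - 1)"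
        by auto
      then show "p \<in> ?O" by (simp only: sol)
    qed (auto simp: inj_on_def)
  qed
  finally show ?thesis .
qed

text \<open>The third claim is what makes the involution send even solutions to odd ones. For x =
  2u, y = 2v, halving the equation gives z odd; then z^2 is 1 modulo 8, the terms 2b cancel, and
  dividing by 4 shows that u^2 + 3v^2 is odd, hence so is u + 3v.\<close>

lemma ternary_sols_parity:
  fixes a b n x y z :: int
  assumes "odd a" "odd b"
    and sol: "(x, y, z) \<in> ternary_sols a (3 * a) (2 * b) (8 * n + 4 * a + 2 * b)"
  shows "odd z" and "even x \<longleftrightarrow> even y" and "even x \<Longrightarrow> odd ((x + 3 * y) div 2)"
proof -
  have eq: "8 * n + 4 * a + 2 * b = a * (x\<^sup>2 + 3 * y\<^sup>2) + 2 * b * z\<^sup>2"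
    using sol by (simp add: ternary_sols_def algebra_simps)
  then have "a * (x\<^sup>2 + 3 * y\<^sup>2) = 2 * (4 * n + 2 * a + b - b * z\<^sup>2)"
    by (simp add: algebra_simps)
  then have "even (a * (x\<^sup>2 + 3 * y\<^sup>2))" by simp
  then show xy: "even x \<longleftrightarrow> even y" using \<open>odd a\<close> by auto
  have "odd z \<and> (even x \<longrightarrow> odd ((x + 3 * y) div 2))"
  proof (cases "even x")
    case True
    then obtain u v where uv: "x = 2 * u" "y = 2 * v" using xy by (auto elim!: evenE)
    have "b * z\<^sup>2 = 2 * (2 * n + a - a * (u\<^sup>2 + 3 * v\<^sup>2)) + b"
      using eq by (simp add: uv algebra_simps)
    then have "odd (b * z\<^sup>2)" using \<open>odd b\<close> by simp
    then have z: "odd z" by simp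
    then obtain k where k: "z\<^sup>2 = 8 * k + 1" by (rule odd_square_int)
    have "a * (u\<^sup>2 + 3 * v\<^sup>2) = 2 * (n - 2 * b * k) + a"
      using eq by (simp add: uv k algebra_simps)
    then have "odd (a * (u\<^sup>2 + 3 * v\<^sup>2))" using \<open>odd a\<close> by simp
    then have "odd (u + 3 * v)" by auto
    moreover have "(x + 3 * y) div 2 = u + 3 * v" by (simp add: uv)
    ultimately show ?thesis using z by simp
  next
    \<comment> \<open>Here x^2 + 3y^2 is 4 modulo 8, so the term 4a cancels modulo 8 and b z^2 is b
      plus an even number.\<close>
    case False
    then obtain i j where ij: "x\<^sup>2 = 8 * i + 1" "y\<^sup>2 = 8 * j + 1"
      using xy odd_square_int by metis
    have "b * z\<^sup>2 = 2 * (2 * n - 2 * a * i - 6 * a * j) + b"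
      using eq by (simp add: ij algebra_simps)
    then have "odd (b * z\<^sup>2)" using \<open>odd b\<close> by simp
    then show ?thesis using False by simp
  qed
  then show "odd z" "even x \<Longrightarrow> odd ((x + 3 * y) div 2)" by auto
qed

lemma card_odd_ternary_sols:
  fixes a b n :: int
  assumes "odd a" "odd b"
  defines "S \<equiv> ternary_sols a (3 * a) (2 * b) (8 * n + 4 * a + 2 * b)"
  assumes fin: "finite S"
  shows "3 * card {(x, y, z) \<in> S. odd x \<and> odd y \<and> odd z} = 2 * card S"
proof -
  \<comment> \<open>Testing the parity of x alone suffices, since x and y have the same parity and z
    is odd on \<open>S\<close>.\<close>
  define E where "E = {(x, y, z) \<in> S. even x}"
  define D where "D = {(x, y, z) \<in> S. odd x \<and> 4 dvd x - y}"
  define D' where "D' = {(x, y, z) \<in> S. odd x \<and> 4 dvd x + y}"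
  define h :: "int \<times> int \<times> int \<Rightarrow> int \<times> int \<times> int"
    where "h = (\<lambda>(x, y, z). ((x + 3 * y) div 2, (x - y) div 2, z))"
  have par: "odd z" "even x \<longleftrightarrow> even y" "even x \<Longrightarrow> odd ((x + 3 * y) div 2)"
    if "(x, y, z) \<in> S" for x y z
    using ternary_sols_parity[OF \<open>odd a\<close> \<open>odd b\<close>] that unfolding S_def by blast+
  have h: "h (x, y, z) \<in> S \<and> h (h (x, y, z)) = (x, y, z)" if "(x, y, z) \<in> S" for x y z
  proof -
    have "even (x - y)" using par(2)[OF that] by simp
    then obtain w where "x - y = 2 * w" by (rule evenE)
    \<comment> \<open>In terms of y and w both halves in \<open>h\<close> are exact, and the
      invariance is the identity (2y + w)^2 + 3w^2 = (y + 2w)^2 + 3y^2.\<close>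
    then have x: "x = y + 2 * w" by simp
    have "h (x, y, z) = (2 * y + w, w, z)" by (simp add: h_def x)
    moreover have "h (2 * y + w, w, z) = (x, y, z)" by (simp add: h_def x)
    moreover have "(2 * y + w, w, z) \<in> S"
      using that by (simp add: S_def ternary_sols_def x power2_eq_square algebra_simps)
    ultimately show ?thesis by simp
  qed
  have ED: "h (x, y, z) \<in> D" if "(x, y, z) \<in> E" for x y z
  proof -
    have xyz: "(x, y, z) \<in> S" "even x" using that by (auto simp: E_def)
    then obtain u v where "x = 2 * u" "y = 2 * v" using par(2) by (metis evenE)
    \<comment> \<open>The first two coordinates of the image differ by 2y, and y is even.\<close>
    then have "(x + 3 * y) div 2 - (x - y) div 2 = 4 * v" by simp
    then have "4 dvd (x + 3 * y) div 2 - (x - y) div 2" by simp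
    then show ?thesis using h[OF xyz(1)] par(3)[OF xyz] by (simp add: D_def h_def)
  qed
  have DE: "h (x, y, z) \<in> E" if "(x, y, z) \<in> D" for x y z
  proof -
    have xyz: "(x, y, z) \<in> S" "4 dvd x - y" using that by (auto simp: D_def)
    then obtain k where "x - y = 4 * k" by (auto elim: dvdE)
    then have "x = y + 4 * k" by simp
    \<comment> \<open>The first coordinate of the image is 2y + (x - y)/2, which is even because 4
      divides x - y.\<close>
    then have "(x + 3 * y) div 2 = 2 * (y + k)" by simp
    then show ?thesis using h[OF xyz(1)] by (simp add: E_def h_def)
  qed
  have "bij_betw h E D"
  proof (rule bij_betw_byWitness[where f' = h])
    show "\<forall>p\<in>E. h (h p) = p" "\<forall>p\<in>D. h (h p) = p"
      using h by (auto simp: E_def D_def)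
    show "h ` E \<subseteq> D" "h ` D \<subseteq> E"
      using ED DE by auto
  qed
  then have cardD: "card D = card E" by (metis bij_betw_same_card)
  have "bij_betw (\<lambda>(x, y, z). (x, - y, z)) D D'"
    by (rule bij_betw_byWitness[where f' = "\<lambda>(x, y, z). (x, - y, z)"])
      (auto simp: D_def D'_def S_def ternary_sols_def)
  then have cardD': "card D' = card D" by (metis bij_betw_same_card)
  \<comment> \<open>Both x - y and x + y are even and their sum 2x is 2 modulo 4, so exactly one of
    them is divisible by 4.\<close>
  have mod4: "4 dvd x - y \<longleftrightarrow> \<not> 4 dvd x + y" if "odd x" "odd y" for x y :: int
    using that by presburger
  have O: "{(x, y, z) \<in> S. odd x \<and> odd y \<and> odd z} = D \<union> D'"
    using par mod4 by (auto simp: D_def D'_def)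
  have disj: "D \<inter> D' = {}"
    using par mod4 by (auto simp: D_def D'_def)
  have S: "S = E \<union> (D \<union> D')" "E \<inter> (D \<union> D') = {}"
    using par mod4 by (auto simp: E_def D_def D'_def)
  have "finite E" "finite D" "finite D'"
    using fin by (auto simp: E_def D_def D'_def intro: finite_subset[rotated])
  then have "card (D \<union> D') = 2 * card E" "card S = card E + card (D \<union> D')"
    using disj S cardD cardD' by (auto simp: card_Un_disjoint)
  then show ?thesis unfolding O by simp
qed

theorem theorem3p1:
  fixes a b n :: nat
  assumes "odd a" and "odd b" and "0 < n"
  shows "real (t_reps [a, 3 * a, 2 * b] n) = 2 / 3 * real (N_reps [a, 3 * a, 2 * b] (8 * n + 4 * a + 2 * b))"
proof -
  let ?S = "ternary_sols (int a) (3 * int a) (2 * int b) (8 * int n + 4 * int a + 2 * int b)"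
  have "0 < a" "0 < b" using assms by (auto intro: odd_pos)
  then have "finite ?S"
    using finite_ternary_sols[of a "3 * a" "2 * b" "8 * n + 4 * a + 2 * b"] by simp
  then have "3 * card {(x, y, z) \<in> ?S. odd x \<and> odd y \<and> odd z} = 2 * card ?S"
    using assms by (intro card_odd_ternary_sols) auto
  \<comment> \<open>The shift by the sum of the coefficients is a + 3a + 2b = 4a + 2b.\<close>
  moreover have "t_reps [a, 3 * a, 2 * b] n = card {(x, y, z) \<in> ?S. odd x \<and> odd y \<and> odd z}"
    using t_reps_ternary[of a "3 * a" "2 * b" n] by (simp add: add.assoc)
  moreover have "N_reps [a, 3 * a, 2 * b] (8 * n + 4 * a + 2 * b) = card ?S"
    using N_reps_ternary[of a "3 * a" "2 * b"] by simp
  ultimately have "3 * t_reps [a, 3 * a, 2 * b] n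
      = 2 * N_reps [a, 3 * a, 2 * b] (8 * n + 4 * a + 2 * b)"
    by simp
  then show ?thesis by linarith
qed

end
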